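(* Let each of $M,N$ be either the torus $T$ or the Klein bottle $K$, viewed as fibre spaces over $S^1$ with fibre $S^1$. Two maps $f,\hat f:M\to N$ over $S^1$ are homotopic over $S^1$ if and only if $q(f)=q(\hat f)$ and $r(f)=r(\hat f)$.
   Context: With $I=[0,1]$ and $S^1\subset\mathbb C$ the unit circle, $T=I\times S^1/(0,z)\sim(1,z)$ and $K=I\times S^1/(0,z)\sim(1,\bar z)$ for $z\in S^1$, each with the standard projection ($p_M$, $p_N$) to $B=I/(0\sim1)=S^1$; the fibre $F_M$ (resp. $F_N$) over $[0]$ is identified with $S^1$. Maps over $S^1$ are continuous maps $f:M\to N$ with $p_N\circ f=p_M$, and homotopies over $S^1$ are homotopies through such maps. For $\epsilon=\pm1$ let $s_\epsilon$ be the section $s_\epsilon([t])=[(t,\epsilon)]$ (of $T$ or $K$). Invariants of a map $f:M\to N$ over $S^1$: $q(f)\in\mathbb Z$ is the degree of $f|:F_M\to F_N$ (it vanishes if $M\neq N$). If $N=T$, $r(f)\in\mathbb Z$ is the degree of the composite $S^1\xrightarrow{f\circ s_{+1}}T=[0,1]\times S^1/\!\sim\ \to S^1$, the last map being projection to the fibre factor. If $N=K$, $r(f)\in\mathbb Z_2$ is $0$ (resp. $1$) if the section $f\circ s_{+1}$ of $K$ is homotopic through sections to $s_{+1}$ (resp. to $s_{-1}$); every section of $K$ is homotopic through sections to exactly one of these. *)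

theory Defs
  imports "HOL-Complex_Analysis.Complex_Analysis" "HOL-Library.Z2"
begin

definition quotient_space :: "'a topology \<Rightarrow> ('a \<times> 'a) set \<Rightarrow> 'a set topology" where
  "quotient_space X R = topology (\<lambda>U. U \<subseteq> topspace X // R \<and> openin X (\<Union>U))"

lemma istopology_quotient_space:
  assumes "equiv (topspace X) R"
  shows "istopology (\<lambda>U. U \<subseteq> topspace X // R \<and> openin X (\<Union>U))"
  unfolding istopology_def
proof (intro conjI allI impI)
  fix S T
  assume S: "S \<subseteq> topspace X // R \<and> openin X (\<Union>S)"
    and T: "T \<subseteq> topspace X // R \<and> openin X (\<Union>T)"
  then show "S \<inter> T \<subseteq> topspace X // R" by blast
  have "\<Union>(S \<inter> T) = \<Union>S \<inter> \<Union>T"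
    using quotient_disj[OF assms] S T by blast
  with S T show "openin X (\<Union>(S \<inter> T))" by (simp add: openin_Int)
next
  fix \<K>
  assume *: "\<forall>K\<in>\<K>. K \<subseteq> topspace X // R \<and> openin X (\<Union>K)"
  then show "\<Union>\<K> \<subseteq> topspace X // R" by blast
  have "\<Union>(\<Union>\<K>) = (\<Union>K\<in>\<K>. \<Union>K)" by blast
  with * show "openin X (\<Union>(\<Union>\<K>))" by (simp add: openin_clauses(3))
qed

lemma openin_quotient_space:
  assumes "equiv (topspace X) R"
  shows "openin (quotient_space X R) U \<longleftrightarrow> U \<subseteq> topspace X // R \<and> openin X (\<Union>U)"
  unfolding quotient_space_def
  by (simp add: topology_inverse'[OF istopology_quotient_space[OF assms]])

lemma topspace_quotient_space:
  assumes "equiv (topspace X) R"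
  shows "topspace (quotient_space X R) = topspace X // R"
proof -
  have "openin (quotient_space X R) (topspace X // R)"
    by (simp add: openin_quotient_space[OF assms] Union_quotient[OF assms])
  then show ?thesis
    by (metis openin_quotient_space[OF assms] openin_subset openin_topspace subset_antisym)
qed

lemma quotient_map_quotient_space:
  assumes "equiv (topspace X) R"
  shows "quotient_map X (quotient_space X R) (\<lambda>x. R `` {x})"
  unfolding quotient_map_def topspace_quotient_space[OF assms]
proof (intro conjI allI impI)
  show "(\<lambda>x. R `` {x}) ` topspace X = topspace X // R"
    by (auto simp: quotient_def)
  fix U assume U: "U \<subseteq> topspace X // R"
  have "{x \<in> topspace X. R `` {x} \<in> U} = \<Union>U"
  proof (intro equalityI subsetI)
    fix x assume "x \<in> {x \<in> topspace X. R `` {x} \<in> U}"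
    then show "x \<in> \<Union>U" using equiv_class_self[OF assms] by blast
  next
    fix x assume "x \<in> \<Union>U"
    then obtain C where C: "C \<in> U" "x \<in> C" by blast
    then obtain y where y: "y \<in> topspace X" "C = R `` {y}"
      using U by (auto elim: quotientE)
    with C have "(y, x) \<in> R" by blast
    then have "R `` {x} = C" "x \<in> topspace X"
      using y equiv_class_eq_iff[OF assms] by metis+
    then show "x \<in> {x \<in> topspace X. R `` {x} \<in> U}" using C by simp
  qed
  then show "openin X {x \<in> topspace X. R `` {x} \<in> U} \<longleftrightarrow> openin (quotient_space X R) U"
    using U by (simp add: openin_quotient_space[OF assms])
qed

text \<open>The map on a quotient induced by a map \<open>h\<close> that is constant on equivalence classes.\<close>

definition induced :: "('a \<Rightarrow> 'b) \<Rightarrow> 'a set \<Rightarrow> 'b" where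
  "induced h c = the_elem (h ` c)"

lemma induced_class:
  assumes "equiv A R" "x \<in> A" "\<And>y. (x, y) \<in> R \<Longrightarrow> h y = h x"
  shows "induced h (R `` {x}) = h x"
proof -
  have "h y = h x" if "y \<in> R `` {x}" for y using that assms(3) by blast
  moreover have "x \<in> R `` {x}" by (rule equiv_class_self[OF assms(1,2)])
  ultimately have "h ` (R `` {x}) = {h x}" by blast
  then show ?thesis by (simp add: induced_def)
qed


definition base_rel :: "(real \<times> real) set" where
  "base_rel = Id_on {0..1} \<union> {(0, 1), (1, 0)}"

definition base :: "real set topology" where
  "base = quotient_space (top_of_set {0..1}) base_rel"

definition bclass :: "real \<Rightarrow> real set" where
  "bclass t = base_rel `` {t}"

text \<open>The identification of \<open>I/(0 \<sim> 1)\<close> with the unit circle, \<open>[t] \<mapsto> exp (2\<pi>it)\<close>.\<close>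

definition base_to_circle :: "real set \<Rightarrow> complex" where
  "base_to_circle = induced (\<lambda>t. cis (2 * pi * t))"

lemma equiv_base_rel: "equiv {0..1} base_rel"
  by (intro equivI) (auto simp: base_rel_def refl_on_def sym_def trans_def)

lemma base_to_circle_bclass:
  assumes "t \<in> {0..1}"
  shows "base_to_circle (bclass t) = cis (2 * pi * t)"
  unfolding base_to_circle_def bclass_def
  by (rule induced_class[OF equiv_base_rel assms]) (auto simp: base_rel_def)

lemma bij_betw_base_to_circle: "bij_betw base_to_circle (topspace base) (sphere 0 1)"
proof -
  have ts: "topspace base = bclass ` {0..1}"
    unfolding base_def using topspace_quotient_space[of "top_of_set {0..1}"] equiv_base_rel
    by (auto simp: quotient_def bclass_def)
  have one: "bclass 1 = bclass 0" by (auto simp: bclass_def base_rel_def)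
  then have ts': "topspace base = bclass ` {0..<1}"
    unfolding ts by (force simp: image_iff le_less)
  have val: "base_to_circle (bclass t) = cis (2 * pi * t)" if "t \<in> {0..<1}" for t
    using that by (intro base_to_circle_bclass) auto
  show ?thesis unfolding bij_betw_def
  proof
    show "inj_on base_to_circle (topspace base)"
    proof (rule inj_onI)
      fix b c assume "b \<in> topspace base" "c \<in> topspace base" and eq: "base_to_circle b = base_to_circle c"
      then obtain s t where st: "s \<in> {0..<1}" "b = bclass s" "t \<in> {0..<1}" "c = bclass t"
        unfolding ts' by blast
      with eq val have c: "cis (2 * pi * s) = cis (2 * pi * t)" by simp
      have arg: "Arg2pi (cis (2 * pi * r)) = 2 * pi * r" if "r \<in> {0..<1}" for r
        using that by (intro Arg2pi_unique[where r=1]) (auto simp: cis_conv_exp)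
      from arg[OF st(1)] arg[OF st(3)] have "2 * pi * s = 2 * pi * t" unfolding c by simp
      then have "s = t" by simp
      with st show "b = c" by simp
    qed
    show "base_to_circle ` topspace base = sphere 0 1"
    proof (intro equalityI subsetI)
      fix w assume "w \<in> base_to_circle ` topspace base"
      then show "w \<in> sphere 0 1" unfolding ts' by (auto simp: val)
    next
      fix w :: complex assume "w \<in> sphere 0 1"
      then have "w = cis (Arg2pi w)"
        using Arg2pi_eq[of w] by (simp add: cis_conv_exp)
      moreover have "Arg2pi w / (2 * pi) \<in> {0..<1}"
        using Arg2pi_ge_0[of w] Arg2pi_lt_2pi[of w] by simp
      ultimately show "w \<in> base_to_circle ` topspace base"
        unfolding ts' using val[of "Arg2pi w / (2 * pi)"]
        by (intro image_eqI[of _ _ "bclass (Arg2pi w / (2 * pi))"]) auto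
    qed
  qed
qed

datatype surface = Torus | Klein

fun gluing :: "surface \<Rightarrow> complex \<Rightarrow> complex" where
  "gluing Torus z = z"
| "gluing Klein z = cnj z"

definition cylinder :: "(real \<times> complex) set" where
  "cylinder = {0..1} \<times> sphere 0 1"

definition glue_rel :: "surface \<Rightarrow> ((real \<times> complex) \<times> (real \<times> complex)) set" where
  "glue_rel M = Id_on cylinder
     \<union> {((0, z), (1, gluing M z)) | z. z \<in> sphere 0 1}
     \<union> {((1, gluing M z), (0, z)) | z. z \<in> sphere 0 1}"

definition total_space :: "surface \<Rightarrow> (real \<times> complex) set topology" where
  "total_space M = quotient_space (top_of_set cylinder) (glue_rel M)"

definition tclass :: "surface \<Rightarrow> real \<times> complex \<Rightarrow> (real \<times> complex) set" where
  "tclass M x = glue_rel M `` {x}"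

definition proj :: "(real \<times> complex) set \<Rightarrow> real set" where
  "proj = induced (\<lambda>(t, z). bclass t)"

lemma equiv_glue_rel: "equiv cylinder (glue_rel M)"
  by (cases M; intro equivI)
     (auto simp: glue_rel_def cylinder_def refl_on_def sym_def trans_def)

lemma proj_tclass:
  assumes "t \<in> {0..1}" "z \<in> sphere 0 1"
  shows "proj (tclass M (t, z)) = bclass t"
proof -
  have "bclass 0 = bclass 1" by (auto simp: bclass_def base_rel_def)
  then show ?thesis
    unfolding proj_def tclass_def
    using assms by (subst induced_class[OF equiv_glue_rel]) (auto simp: cylinder_def glue_rel_def)
qed


definition over_base :: "surface \<Rightarrow> ((real \<times> complex) set \<Rightarrow> (real \<times> complex) set) \<Rightarrow> bool" where
  "over_base M f \<longleftrightarrow> (\<forall>x \<in> topspace (total_space M). proj (f x) = proj x)"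

definition map_over :: "surface \<Rightarrow> surface \<Rightarrow> ((real \<times> complex) set \<Rightarrow> (real \<times> complex) set) \<Rightarrow> bool" where
  "map_over M N f \<longleftrightarrow> continuous_map (total_space M) (total_space N) f \<and> over_base M f"

definition homotopic_over ::
  "surface \<Rightarrow> surface \<Rightarrow> ((real \<times> complex) set \<Rightarrow> (real \<times> complex) set)
     \<Rightarrow> ((real \<times> complex) set \<Rightarrow> (real \<times> complex) set) \<Rightarrow> bool" where
  "homotopic_over M N = homotopic_with (over_base M) (total_space M) (total_space N)"

definition homotopic_sections ::
  "surface \<Rightarrow> (real set \<Rightarrow> (real \<times> complex) set) \<Rightarrow> (real set \<Rightarrow> (real \<times> complex) set) \<Rightarrow> bool" where
  "homotopic_sections N =
     homotopic_with (\<lambda>s. \<forall>b \<in> topspace base. proj (s b) = b) base (total_space N)"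

text \<open>The section \<open>[t] \<mapsto> [(t, e)]\<close>; it is well defined for \<open>e = 1\<close> and \<open>e = -1\<close>.\<close>

definition const_section :: "surface \<Rightarrow> complex \<Rightarrow> real set \<Rightarrow> (real \<times> complex) set" where
  "const_section M e = induced (\<lambda>t. tclass M (t, e))"

lemma const_section_bclass:
  assumes "t \<in> {0..1}" "e \<in> {1, -1}"
  shows "const_section M e (bclass t) = tclass M (t, e)"
proof -
  have "(0, e) \<in> cylinder" "((0, e), (1, e)) \<in> glue_rel M"
    using assms(2) by (cases M; auto simp: cylinder_def glue_rel_def)+
  then have "tclass M (0, e) = tclass M (1, e)"
    unfolding tclass_def using equiv_class_eq[OF equiv_glue_rel] by blast
  then show ?thesis
    unfolding const_section_def bclass_def
    using assms by (intro induced_class[OF equiv_base_rel]) (auto simp: base_rel_def)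
qed

text \<open>The degree of a continuous self-map of the unit circle, as the number of times the
  image of the standard loop winds around the origin.\<close>

definition circle_degree :: "(complex \<Rightarrow> complex) \<Rightarrow> int" where
  "circle_degree g = (THE d. winding_number (g \<circ> circlepath 0 1) 0 = of_int d)"

lemma circle_degree_eq:
  assumes "continuous_on (sphere 0 1) g" "g ` sphere 0 1 \<subseteq> sphere 0 1"
  shows "of_int (circle_degree g) = winding_number (g \<circ> circlepath 0 1) 0"
proof -
  have im: "path_image (circlepath 0 1) = sphere (0::complex) 1" by simp
  have "path (g \<circ> circlepath 0 1)"
    using assms(1) by (intro path_continuous_image) auto
  moreover have "0 \<notin> path_image (g \<circ> circlepath 0 1)"
    using assms(2) im by (auto simp: path_image_compose)
  moreover have "pathfinish (g \<circ> circlepath 0 1) = pathstart (g \<circ> circlepath 0 1)"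
    by (simp add: pathfinish_compose pathstart_compose)
  ultimately have "winding_number (g \<circ> circlepath 0 1) 0 \<in> \<int>"
    by (intro integer_winding_number)
  then obtain d where "winding_number (g \<circ> circlepath 0 1) 0 = of_int d"
    by (elim Ints_cases)
  then show ?thesis by (simp add: circle_degree_def)
qed

text \<open>The identification \<open>z \<mapsto> [(0, z)]\<close> of the unit circle with the fibre over \<open>[0]\<close>.\<close>

definition fibre_incl :: "surface \<Rightarrow> complex \<Rightarrow> (real \<times> complex) set" where
  "fibre_incl M z = tclass M (0, z)"

lemma bij_betw_fibre_incl:
  "bij_betw (fibre_incl M) (sphere 0 1) {x \<in> topspace (total_space M). proj x = bclass 0}"
proof -
  have ts: "topspace (total_space M) = cylinder // glue_rel M"
    unfolding total_space_def using topspace_quotient_space[of "top_of_set cylinder"] equiv_glue_rel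
    by simp
  have "inj_on (fibre_incl M) (sphere 0 1)"
  proof (rule inj_onI)
    fix z w :: complex
    assume "z \<in> sphere 0 1" "w \<in> sphere 0 1" "fibre_incl M z = fibre_incl M w"
    then have "((0, z), (0, w)) \<in> glue_rel M"
      unfolding fibre_incl_def tclass_def
      by (intro eq_equiv_class[OF _ equiv_glue_rel]) (auto simp: cylinder_def)
    then show "z = w" by (auto simp: glue_rel_def)
  qed
  moreover have "fibre_incl M ` sphere 0 1 = {x \<in> topspace (total_space M). proj x = bclass 0}"
  proof (intro equalityI subsetI)
    fix x assume "x \<in> fibre_incl M ` sphere 0 1"
    then obtain z where z: "z \<in> sphere 0 1" "x = tclass M (0, z)"
      by (auto simp: fibre_incl_def)
    then have "x \<in> cylinder // glue_rel M"
      unfolding tclass_def by (auto intro!: quotientI simp: cylinder_def)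
    with z show "x \<in> {x \<in> topspace (total_space M). proj x = bclass 0}"
      by (simp add: ts proj_tclass)
  next
    fix x assume "x \<in> {x \<in> topspace (total_space M). proj x = bclass 0}"
    then obtain t z where x: "t \<in> {0..1}" "z \<in> sphere 0 1" "x = tclass M (t, z)"
      and p: "proj x = bclass 0"
      unfolding ts by (auto simp: quotient_def tclass_def cylinder_def)
    then have "bclass t = bclass 0" by (simp add: proj_tclass)
    then have "(t, 0) \<in> base_rel"
      using x(1) unfolding bclass_def by (intro eq_equiv_class[OF _ equiv_base_rel]) auto
    then consider "t = 0" | "t = 1" by (auto simp: base_rel_def)
    then show "x \<in> fibre_incl M ` sphere 0 1"
    proof cases
      case 1
      with x show ?thesis by (auto simp: fibre_incl_def)
    next
      case 2
      have g: "gluing M z \<in> sphere 0 1" "gluing M (gluing M z) = z"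
        using x(2) by (cases M; simp)+
      then have "((0, gluing M z), (1, z)) \<in> glue_rel M"
        unfolding glue_rel_def by force
      then have "tclass M (0, gluing M z) = x"
        unfolding x(3) 2 tclass_def by (rule equiv_class_eq[OF equiv_glue_rel])
      with g show ?thesis by (auto simp: fibre_incl_def)
    qed
  qed
  ultimately show ?thesis by (simp add: bij_betw_def)
qed

definition fibre_degree ::
  "surface \<Rightarrow> surface \<Rightarrow> ((real \<times> complex) set \<Rightarrow> (real \<times> complex) set) \<Rightarrow> int" where
  "fibre_degree M N f =
     circle_degree (\<lambda>z. inv_into (sphere 0 1) (fibre_incl N) (f (fibre_incl M z)))"

definition torus_fibre_coord :: "(real \<times> complex) set \<Rightarrow> complex" where
  "torus_fibre_coord = induced snd"

lemma torus_fibre_coord_tclass: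
  assumes "t \<in> {0..1}" "z \<in> sphere 0 1"
  shows "torus_fibre_coord (tclass Torus (t, z)) = z"
  unfolding torus_fibre_coord_def tclass_def
  using assms by (subst induced_class[OF equiv_glue_rel]) (auto simp: cylinder_def glue_rel_def)

text \<open>The second invariant takes values in \<open>\<int>\<close> (left summand) for maps into the torus and in
  \<open>\<int>\<^sub>2\<close> (right summand) for maps into the Klein bottle.\<close>

fun section_invariant ::
  "surface \<Rightarrow> surface \<Rightarrow> ((real \<times> complex) set \<Rightarrow> (real \<times> complex) set) \<Rightarrow> int + bit" where
  "section_invariant M Torus f =
     Inl (circle_degree (torus_fibre_coord \<circ> f \<circ> const_section M 1
            \<circ> inv_into (topspace base) base_to_circle))"
| "section_invariant M Klein f =
     Inr (THE r. (r = 0 \<and> homotopic_sections Klein (f \<circ> const_section M 1) (const_section Klein 1))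
               \<or> (r = 1 \<and> homotopic_sections Klein (f \<circ> const_section M 1) (const_section Klein (-1))))"

end

theory Submission
  imports Defs
begin

text \<open>A map \<open>f\<close> over the circle lifts to \<open>F : [0,1] \<times> S\<^sup>1 \<rightarrow> S\<^sup>1\<close> with \<open>f [t, z] = [t, F (t, z)]\<close>, and a homotopy
  over the circle lifts to a homotopy of such maps; hence the invariants are homotopy invariants.
  Conversely, let \<open>F\<close> and \<open>G\<close> be the lifts of \<open>f\<close> and \<open>g\<close>. If the fibre degrees agree, \<open>G / F\<close> is null-homotopic, so
  \<open>G = F \<cdot> exp (i\<theta>)\<close> for a real function \<open>\<theta>\<close>. The gluing condition says that \<open>\<theta> (1, \<gamma> z) \<mp> \<theta> (0, z)\<close> is a
  constant \<open>2\<pi>n\<close>, where \<open>\<gamma>\<close> is the gluing of the source and the sign is \<open>-\<close> for \<open>N = T\<close> and \<open>+\<close> for \<open>N = K\<close>.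
  Equality of the second invariant means \<open>n = 0\<close> if \<open>N = T\<close>, and that \<open>n\<close> is even if \<open>N = K\<close>; in the latter case
  subtracting \<open>\<pi>n\<close> from \<open>\<theta>\<close> makes the constant vanish. Then \<open>F \<cdot> exp (is\<theta>)\<close> is a homotopy of lifts that
  respects the gluing for every \<open>s\<close>.\<close>

subsection \<open>Lifting to the fibre coordinate\<close>

lemma quotient_map_tclass: "quotient_map (top_of_set cylinder) (total_space M) (tclass M)"
  using quotient_map_quotient_space[of "top_of_set cylinder" "glue_rel M"] equiv_glue_rel
  by (simp add: total_space_def tclass_def[abs_def])

lemma quotient_map_bclass: "quotient_map (top_of_set {0..1}) base bclass"
  using quotient_map_quotient_space[of "top_of_set {0..1}" base_rel] equiv_base_rel
  by (simp add: base_def bclass_def[abs_def])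

lemma topspace_total_space: "topspace (total_space M) = tclass M ` cylinder"
  using quotient_map_tclass[of M] by (simp add: quotient_map_def)

lemma topspace_base: "topspace base = bclass ` {0..1}"
  using quotient_map_bclass by (simp add: quotient_map_def)

lemma tclass_eq_iff:
  assumes "x \<in> cylinder" "y \<in> cylinder"
  shows "tclass M x = tclass M y \<longleftrightarrow> (x, y) \<in> glue_rel M"
  unfolding tclass_def using assms eq_equiv_class_iff[OF equiv_glue_rel] by blast

lemma bclass_eq_iff:
  assumes "s \<in> {0..1}" "t \<in> {0..1}"
  shows "bclass s = bclass t \<longleftrightarrow> s = t \<or> (s = 0 \<and> t = 1) \<or> (s = 1 \<and> t = 0)"
  unfolding bclass_def using assms eq_equiv_class_iff[OF equiv_base_rel, of s t]
  by (auto simp: base_rel_def)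

lemma norm_gluing [simp]: "cmod (gluing M z) = cmod z"
  by (cases M) auto

lemma gluing_gluing [simp]: "gluing M (gluing M z) = z"
  by (cases M) auto

lemma gluing_1 [simp]: "gluing M 1 = 1"
  by (cases M) auto

lemma tclass_same_height:
  assumes "t \<in> {0..1}" "z \<in> sphere 0 1" "w \<in> sphere 0 1"
  shows "tclass M (t, z) = tclass M (t, w) \<longleftrightarrow> z = w"
  using assms by (subst tclass_eq_iff) (auto simp: cylinder_def glue_rel_def)

lemma tclass_ends:
  assumes "z \<in> sphere 0 1" "w \<in> sphere 0 1"
  shows "tclass M (0, z) = tclass M (1, w) \<longleftrightarrow> w = gluing M z"
  using assms by (subst tclass_eq_iff) (auto simp: cylinder_def glue_rel_def)

text \<open>Lets a lift keep a prescribed height even at the seam. Since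
  \<open>bclass 0 = bclass 1\<close>, a point over \<open>bclass t\<close> may come represented at
  the opposite end; the gluing, being an involution, moves it to height \<open>t\<close> in either
  direction.\<close>

lemma tclass_over:
  assumes "x \<in> topspace (total_space M)" "t \<in> {0..1}" "proj x = bclass t"
  obtains w where "w \<in> sphere 0 1" "x = tclass M (t, w)"
proof -
  obtain s z where x: "s \<in> {0..1}" "z \<in> sphere 0 1" "x = tclass M (s, z)"
    using assms(1) by (auto simp: topspace_total_space cylinder_def)
  with assms have "bclass s = bclass t" by (simp add: proj_tclass)
  then consider "s = t" | "s = 0" "t = 1" | "s = 1" "t = 0"
    using bclass_eq_iff x(1) assms(2) by blast
  then show thesis
  proof cases
    case 1
    with x that show thesis by blast
  next
    case 2
    then have "x = tclass M (t, gluing M z)"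
      using x tclass_ends[of z "gluing M z" M] by simp
    with x that[of "gluing M z"] show thesis by simp
  next
    case 3
    then have "x = tclass M (t, gluing M z)"
      using x tclass_ends[of "gluing M z" z M] by simp
    with x that[of "gluing M z"] show thesis by simp
  qed
qed

text \<open>A continuous function on \<open>total_space N\<close> that separates the points of each fibre. On the Klein
  bottle, the sign change of \<open>Im z\<close> under the gluing is compensated by \<open>cis \<pi> = -1\<close>.\<close>

fun fibre_coord :: "surface \<Rightarrow> real \<times> complex \<Rightarrow> complex \<times> complex" where
  "fibre_coord Torus (t, z) = (z, 0)"
| "fibre_coord Klein (t, z) = (of_real (Re z), of_real (Im z) * cis (pi * t))"

lemma fibre_coord_eq_iff: "fibre_coord N (t, z) = fibre_coord N (t, w) \<longleftrightarrow> z = w"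
  by (cases N) (auto intro: complex_eqI)

lemma continuous_on_fibre_coord: "continuous_on S (fibre_coord N)"
proof (cases N)
  case Torus
  then have "fibre_coord N = (\<lambda>x. (snd x, 0))" by (auto simp: fun_eq_iff)
  then show ?thesis by (auto intro!: continuous_intros)
next
  case Klein
  then have "fibre_coord N = (\<lambda>x. (of_real (Re (snd x)), of_real (Im (snd x)) * cis (pi * fst x)))"
    by (auto simp: fun_eq_iff)
  then show ?thesis by (auto intro!: continuous_intros)
qed

lemma fibre_coord_descends:
  obtains e where "continuous_map (total_space N) euclidean e"
    "\<And>x. x \<in> cylinder \<Longrightarrow> e (tclass N x) = fibre_coord N x"
proof -
  have "fibre_coord N x = fibre_coord N y"
    if "x \<in> cylinder" "y \<in> cylinder" "tclass N x = tclass N y" for x y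
    using that by (cases N) (auto simp: tclass_eq_iff glue_rel_def)
  moreover have "continuous_map (top_of_set cylinder) euclidean (fibre_coord N)"
    by (simp add: continuous_on_fibre_coord)
  ultimately show thesis
    using quotient_map_lift_exists[OF quotient_map_tclass[of N], of euclidean "fibre_coord N"] that
    by (metis topspace_euclidean_subtopology)
qed

text \<open>The lift is continuous because its graph is the equaliser of two continuous maps into a
  Hausdorff space and the circle is compact.\<close>

lemma total_space_lift:
  fixes S :: "'a::euclidean_space set"
  assumes c: "continuous_map (top_of_set S) (total_space N) c"
    and \<tau>: "continuous_on S \<tau>" "\<tau> \<in> S \<rightarrow> {0..1}"
    and over: "\<And>x. x \<in> S \<Longrightarrow> proj (c x) = bclass (\<tau> x)"
  obtains F where "continuous_on S F" "F \<in> S \<rightarrow> sphere 0 1"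
    "\<And>x. x \<in> S \<Longrightarrow> c x = tclass N (\<tau> x, F x)"
proof -
  have "\<exists>w. w \<in> sphere 0 1 \<and> c x = tclass N (\<tau> x, w)" if "x \<in> S" for x
  proof -
    have "c x \<in> topspace (total_space N)" "\<tau> x \<in> {0..1}"
      using continuous_map_image_subset_topspace[OF c] \<tau>(2) that by auto
    then show ?thesis
      using over[OF that] by (metis tclass_over)
  qed
  then obtain F where F: "\<And>x. x \<in> S \<Longrightarrow> F x \<in> sphere 0 1 \<and> c x = tclass N (\<tau> x, F x)"
    by metis
  obtain e where e: "continuous_map (total_space N) euclidean e"
    "\<And>x. x \<in> cylinder \<Longrightarrow> e (tclass N x) = fibre_coord N x"
    using fibre_coord_descends[of N] by blast
  have ec: "continuous_on S (e \<circ> c)"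
    using continuous_map_compose[OF c e(1)] by simp
  have Fim: "F \<in> S \<rightarrow> sphere 0 1" using F by blast
  \<comment> \<open>At a fixed height \<open>fibre_coord\<close> is injective in the fibre variable,
    so the equation singles out \<open>F x\<close> among all points of the circle.\<close>
  have graph: "(\<lambda>x. (x, F x)) ` S
      = {p \<in> S \<times> sphere 0 1. (e \<circ> c) (fst p) - fibre_coord N (\<tau> (fst p), snd p) = 0}"
  proof -
    have "(e \<circ> c) x = fibre_coord N (\<tau> x, w) \<longleftrightarrow> w = F x" if "x \<in> S" "w \<in> sphere 0 1" for x w
    proof -
      have "(\<tau> x, F x) \<in> cylinder" using F[OF that(1)] \<tau>(2) that by (auto simp: cylinder_def)
      then have "(e \<circ> c) x = fibre_coord N (\<tau> x, F x)"
        using F[OF that(1)] e(2) by simp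
      then show ?thesis by (auto simp: fibre_coord_eq_iff)
    qed
    with F show ?thesis by auto
  qed
  have "continuous_on (S \<times> sphere 0 1) (\<lambda>p. (e \<circ> c) (fst p) - fibre_coord N (\<tau> (fst p), snd p))"
    by (intro continuous_on_diff continuous_on_compose2[OF ec] 
        continuous_on_compose2[OF continuous_on_fibre_coord[of UNIV]] continuous_on_Pair
        continuous_on_compose2[OF \<tau>(1)] continuous_on_fst continuous_on_snd continuous_on_id) auto
  then have "closedin (top_of_set (S \<times> sphere 0 1))
      ((S \<times> sphere 0 1) \<inter> (\<lambda>p. (e \<circ> c) (fst p) - fibre_coord N (\<tau> (fst p), snd p)) -` {0})"
    by (intro continuous_closedin_preimage) auto
  also have "(S \<times> sphere 0 1) \<inter> (\<lambda>p. (e \<circ> c) (fst p) - fibre_coord N (\<tau> (fst p), snd p)) -` {0}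
      = (\<lambda>x. (x, F x)) ` S"
    unfolding graph by auto
  finally have "continuous_on S F"
    using continuous_closed_graph_eq[of "sphere 0 1" F S] Fim by simp
  then show thesis using that F Fim by blast
qed

subsection \<open>Spaces over the base\<close>

text \<open>A common setting for maps and sections: \<open>X\<close> is the space before gluing,
  \<open>\<tau>\<close> its height function, and \<open>b\<close> the projection of the quotient
  \<open>Q\<close> to the base. With \<open>Q = base\<close> the maps satisfying \<open>over\<close>
  are sections; with \<open>Q = total_space M\<close> they are maps over the circle.\<close>

locale space_over_base =
  fixes X :: "'a::euclidean_space set" and Q :: "'q topology" and \<pi> :: "'a \<Rightarrow> 'q"
    and \<tau> :: "'a \<Rightarrow> real" and b :: "'q \<Rightarrow> real set"
  assumes quotient: "quotient_map (top_of_set X) Q \<pi>"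
    and cont_\<tau>: "continuous_on X \<tau>"
    and \<tau>_range: "\<tau> \<in> X \<rightarrow> {0..1}"
    and b_\<pi>: "x \<in> X \<Longrightarrow> b (\<pi> x) = bclass (\<tau> x)"
begin

definition over :: "('q \<Rightarrow> (real \<times> complex) set) \<Rightarrow> bool" where
  "over j \<longleftrightarrow> (\<forall>q \<in> topspace Q. proj (j q) = b q)"

lemma topspace_Q: "topspace Q = \<pi> ` X"
  using quotient by (simp add: quotient_map_def)

lemma over_lift:
  assumes "continuous_map Q (total_space N) f" "over f"
  obtains F where "continuous_on X F" "F \<in> X \<rightarrow> sphere 0 1"
    "\<And>x. x \<in> X \<Longrightarrow> f (\<pi> x) = tclass N (\<tau> x, F x)"
proof (rule total_space_lift[of X N "f \<circ> \<pi>" \<tau>])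
  show "continuous_map (top_of_set X) (total_space N) (f \<circ> \<pi>)"
    using continuous_map_compose quotient_imp_continuous_map[OF quotient] assms(1) by blast
  show "proj ((f \<circ> \<pi>) x) = bclass (\<tau> x)" if "x \<in> X" for x
    using that assms(2) by (simp add: over_def topspace_Q b_\<pi>)
qed (use cont_\<tau> \<tau>_range that in auto)

text \<open>The homotopy is pulled back to \<open>{0..1} \<times> X\<close> and lifted there. Its
  ends are the given lifts because a point of \<open>total_space N\<close> has only one
  representative at a given height. The last conclusion records that every stage of the homotopy
  came from a map on \<open>Q\<close>.\<close>

lemma homotopy_lift:
  assumes hom: "homotopic_with over Q (total_space N) f g"
    and F: "F \<in> X \<rightarrow> sphere 0 1" "\<And>x. x \<in> X \<Longrightarrow> f (\<pi> x) = tclass N (\<tau> x, F x)"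
    and G: "G \<in> X \<rightarrow> sphere 0 1" "\<And>x. x \<in> X \<Longrightarrow> g (\<pi> x) = tclass N (\<tau> x, G x)"
  obtains H where "continuous_on ({0..1} \<times> X) H" "H \<in> {0..1::real} \<times> X \<rightarrow> sphere 0 1"
    "\<And>x. x \<in> X \<Longrightarrow> H (0, x) = F x" "\<And>x. x \<in> X \<Longrightarrow> H (1, x) = G x"
    "\<And>s x y. s \<in> {0..1} \<Longrightarrow> x \<in> X \<Longrightarrow> y \<in> X \<Longrightarrow> \<pi> x = \<pi> y \<Longrightarrow>
       tclass N (\<tau> x, H (s, x)) = tclass N (\<tau> y, H (s, y))"
proof -
  obtain h where h: "continuous_map (prod_topology (top_of_set {0..1::real}) Q) (total_space N) h"
      "\<And>x. h (0, x) = f x" "\<And>x. h (1, x) = g x" "\<And>s. s \<in> {0..1} \<Longrightarrow> over (\<lambda>x. h (s, x))"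
    using hom by (auto simp: homotopic_with_def)
  have "continuous_map (prod_topology (top_of_set {0..1}) (top_of_set X))
      (prod_topology (top_of_set {0..1}) Q) (\<lambda>p. (fst p, \<pi> (snd p)))"
    using continuous_map_fst continuous_map_compose[OF continuous_map_snd
        quotient_imp_continuous_map[OF quotient]]
    by (simp only: continuous_map_pairwise o_def fst_conv snd_conv simp_thms) blast
  from continuous_map_compose[OF this h(1)]
  have cont: "continuous_map (top_of_set ({0..1} \<times> X)) (total_space N) (\<lambda>p. h (fst p, \<pi> (snd p)))"
    by (simp only: prod_topology_subtopology_eu o_def)
  have cont\<tau>: "continuous_on ({0..1::real} \<times> X) (\<lambda>p. \<tau> (snd p))"
    by (intro continuous_on_compose2[OF cont_\<tau>] continuous_intros) auto
  have range: "(\<lambda>p. \<tau> (snd p)) \<in> {0..1::real} \<times> X \<rightarrow> {0..1}"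
    using \<tau>_range by auto
  have proj: "proj (h (fst p, \<pi> (snd p))) = bclass (\<tau> (snd p))" if "p \<in> {0..1} \<times> X" for p
  proof -
    have "fst p \<in> {0..1}" "snd p \<in> X" using that by auto
    then show ?thesis using h(4)[of "fst p"] by (simp add: over_def topspace_Q b_\<pi>)
  qed
  obtain H where H: "continuous_on ({0..1} \<times> X) H" "H \<in> {0..1} \<times> X \<rightarrow> sphere 0 1"
      "\<And>p. p \<in> {0..1} \<times> X \<Longrightarrow> h (fst p, \<pi> (snd p)) = tclass N (\<tau> (snd p), H p)"
    using total_space_lift[OF cont cont\<tau> range proj] by blast
  show thesis
  proof
    fix x assume x: "x \<in> X"
    have "\<tau> x \<in> {0..1}" "H (0, x) \<in> sphere 0 1" "H (1, x) \<in> sphere 0 1"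
        "F x \<in> sphere 0 1" "G x \<in> sphere 0 1"
      using x \<tau>_range H(2) F(1) G(1) by auto
    moreover have "tclass N (\<tau> x, F x) = tclass N (\<tau> x, H (0, x))"
        "tclass N (\<tau> x, G x) = tclass N (\<tau> x, H (1, x))"
      using H(3)[of "(0, x)"] H(3)[of "(1, x)"] h(2,3) F(2) G(2) x by auto
    ultimately show "H (0, x) = F x" "H (1, x) = G x"
      by (simp_all add: tclass_same_height)
  next
    fix s x y assume "s \<in> {0..1::real}" "x \<in> X" "y \<in> X" "\<pi> x = \<pi> y"
    then show "tclass N (\<tau> x, H (s, x)) = tclass N (\<tau> y, H (s, y))"
      using H(3)[of "(s, x)"] H(3)[of "(s, y)"] by simp
  qed (rule H)+
qed

text \<open>A partial converse of \<open>homotopy_lift\<close>: if the lifts differ by an angle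
  \<open>\<theta>\<close>, rotating by \<open>s * \<theta>\<close> joins them, and this descends to
  \<open>Q\<close> as soon as each stage respects the identifications made by
  \<open>\<pi>\<close>.\<close>

lemma homotopic_rotation:
  assumes F: "continuous_on X F" "F \<in> X \<rightarrow> sphere 0 1"
      "\<And>x. x \<in> X \<Longrightarrow> f (\<pi> x) = tclass N (\<tau> x, F x)"
    and \<theta>: "continuous_on X \<theta>"
    and G: "\<And>x. x \<in> X \<Longrightarrow> g (\<pi> x) = tclass N (\<tau> x, F x * cis (\<theta> x))"
    and compat: "\<And>s x y. s \<in> {0..1} \<Longrightarrow> x \<in> X \<Longrightarrow> y \<in> X \<Longrightarrow> \<pi> x = \<pi> y \<Longrightarrow>
       tclass N (\<tau> x, F x * cis (s * \<theta> x)) = tclass N (\<tau> y, F y * cis (s * \<theta> y))"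
  shows "homotopic_with over Q (total_space N) f g"
proof -
  define k where "k = (\<lambda>p. tclass N (\<tau> (snd p), F (snd p) * cis (fst p * \<theta> (snd p))))"
  let ?I = "top_of_set {0..1::real}"
  have "continuous_on ({0..1} \<times> X) (\<lambda>p. (\<tau> (snd p), F (snd p) * cis (fst p * \<theta> (snd p))))"
    by (intro continuous_intros continuous_on_compose2[OF cont_\<tau>] continuous_on_compose2[OF F(1)]
        continuous_on_compose2[OF \<theta>]) auto
  moreover have "(\<lambda>p. (\<tau> (snd p), F (snd p) * cis (fst p * \<theta> (snd p)))) \<in> {0..1} \<times> X \<rightarrow> cylinder"
    using \<tau>_range F(2) by (fastforce simp: cylinder_def norm_mult)
  ultimately have "continuous_map (top_of_set ({0..1} \<times> X)) (top_of_set cylinder)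
      (\<lambda>p. (\<tau> (snd p), F (snd p) * cis (fst p * \<theta> (snd p))))"
    by auto
  from continuous_map_compose[OF this quotient_imp_continuous_map[OF quotient_map_tclass[of N]]]
  have k: "continuous_map (prod_topology ?I (top_of_set X)) (total_space N) k"
    by (simp add: k_def o_def prod_topology_subtopology_eu)
  \<comment> \<open>The interval is compact Hausdorff, hence locally compact, so its product with
    the quotient map \<open>\<pi>\<close> is again a quotient map; this is what makes the descended
    homotopy jointly continuous.\<close>
  have quot: "quotient_map (prod_topology ?I (top_of_set X)) (prod_topology ?I Q) (\<lambda>(s, x). (s, \<pi> x))"
    by (rule quotient_map_prod_right[OF _ _ quotient])
      (auto intro: compact_imp_locally_compact_space Hausdorff_space_subtopology
        simp: compact_space_subtopology)
  obtain h where h: "continuous_map (prod_topology ?I Q) (total_space N) h"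
    and hk: "\<And>p. p \<in> topspace (prod_topology ?I (top_of_set X)) \<Longrightarrow> h ((\<lambda>(s, x). (s, \<pi> x)) p) = k p"
  proof (rule quotient_map_lift_exists[OF quot k])
    fix p q :: "real \<times> 'a"
    assume "p \<in> topspace (prod_topology ?I (top_of_set X))" "q \<in> topspace (prod_topology ?I (top_of_set X))"
      "(\<lambda>(s, x). (s, \<pi> x)) p = (\<lambda>(s, x). (s, \<pi> x)) q"
    then show "k p = k q"
      using compat[of "fst p" "snd p" "snd q"] by (cases p, cases q) (simp add: k_def)
  qed (rule that)
  have hval: "h (s, \<pi> x) = tclass N (\<tau> x, F x * cis (s * \<theta> x))" if "s \<in> {0..1}" "x \<in> X" for s x
    using hk[of "(s, x)"] that by (simp add: k_def)
  show ?thesis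
  proof (subst homotopic_with)
    \<comment> \<open>The pointwise description of \<open>homotopic_with\<close> applies to
      properties that depend only on values on \<open>topspace Q\<close>.\<close>
    show "over j \<longleftrightarrow> over j'" if "\<And>x. x \<in> topspace Q \<Longrightarrow> j x = j' x" for j j'
      using that by (simp add: over_def)
    have "over (\<lambda>x. h (s, x))" if "s \<in> {0..1}" for s
    proof -
      have "cmod (F x * cis (s * \<theta> x)) = 1 \<and> \<tau> x \<in> {0..1}" if "x \<in> X" for x
        using that F(2) \<tau>_range by (auto simp: norm_mult)
      with that show ?thesis
        by (auto simp: over_def topspace_Q hval b_\<pi> intro!: proj_tclass)
    qed
    then show "\<exists>h. continuous_map (prod_topology ?I Q) (total_space N) h \<and>
        (\<forall>x\<in>topspace Q. h (0, x) = f x) \<and> (\<forall>x\<in>topspace Q. h (1, x) = g x) \<and>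
        (\<forall>t\<in>{0..1}. over (\<lambda>x. h (t, x)))"
      using h by (intro exI[of _ h]) (auto simp: topspace_Q hval F(3) G)
  qed
qed

end

subsection \<open>Circle-valued maps\<close>

lemma cis_eq_iff: "cis a = cis b \<longleftrightarrow> (\<exists>n::int. a = b + 2 * pi * n)"
proof -
  have "cis a = cis b \<longleftrightarrow> (\<exists>n::int. \<i> * of_real a = \<i> * of_real b + (of_int (2 * n) * pi) * \<i>)"
    unfolding cis_conv_exp exp_eq ..
  also have "\<dots> \<longleftrightarrow> (\<exists>n::int. a = b + 2 * pi * n)"
    by (simp add: complex_eq_iff mult_ac)
  finally show ?thesis .
qed

text \<open>The values lie in the multiples of \<open>2 * pi\<close>, distinct ones at least
  \<open>2 * pi\<close> apart, and a continuous function on a connected set cannot jump between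
  them.\<close>

lemma continuous_cis_eq_1_constant:
  fixes d :: "'a::topological_space \<Rightarrow> real"
  assumes "connected S" "continuous_on S d" "\<And>x. x \<in> S \<Longrightarrow> cis (d x) = 1"
  obtains n :: int where "\<And>x. x \<in> S \<Longrightarrow> d x = 2 * pi * n"
proof (cases "S = {}")
  case False
  have int: "\<exists>n::int. d x = 2 * pi * n" if "x \<in> S" for x
    using assms(3)[OF that] cis_eq_iff[of "d x" 0] by simp
  have "d constant_on S"
  proof (rule continuous_discrete_range_constant[OF assms(1,2)])
    fix x assume x: "x \<in> S"
    have "2 * pi \<le> norm (d y - d x)" if y: "y \<in> S" "d y \<noteq> d x" for y
    proof -
      obtain m n :: int where mn: "d y = 2 * pi * m" "d x = 2 * pi * n"
        using int x y(1) by metis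
      with y(2) have "1 \<le> \<bar>m - n\<bar>" by auto
      then have "1 \<le> \<bar>real_of_int m - real_of_int n\<bar>" by linarith
      then have "2 * pi * 1 \<le> 2 * pi * \<bar>real_of_int m - real_of_int n\<bar>"
        by (intro mult_left_mono) auto
      also have "\<dots> = norm (d y - d x)"
        by (simp add: mn abs_mult flip: right_diff_distrib)
      finally show ?thesis by simp
    qed
    then show "\<exists>e>0. \<forall>y. y \<in> S \<and> d y \<noteq> d x \<longrightarrow> e \<le> norm (d y - d x)"
      by (intro exI[of _ "2 * pi"]) auto
  qed
  with int False that show thesis unfolding constant_on_def by (metis ex_in_conv)
qed (use that in auto)

text \<open>The quotient of two homotopic circle-valued maps is inessential, hence has a continuous
  logarithm, which is purely imaginary.\<close>

lemma homotopic_circlemaps_imp_cis_factor: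
  fixes f g :: "'a::real_normed_vector \<Rightarrow> complex"
  assumes "homotopic_with_canon (\<lambda>x. True) S (sphere 0 1) g f"
  obtains \<theta> where "continuous_on S \<theta>" "\<And>x. x \<in> S \<Longrightarrow> g x = f x * cis (\<theta> x)"
proof -
  obtain \<theta> where \<theta>: "continuous_on S \<theta>" "\<And>x. x \<in> S \<Longrightarrow> g x / f x = exp (\<i> * of_real (\<theta> x))"
    using assms homotopic_circlemaps_divide inessential_eq_continuous_logarithm_circle[of S "\<lambda>x. g x / f x"]
    by blast
  moreover have "f x \<noteq> 0" if "x \<in> S" for x
    using homotopic_with_imp_subset2[OF assms] that by force
  ultimately show thesis
    using that by (force simp: cis_conv_exp field_simps)
qed

lemma contractible_imp_cis_lift:
  fixes f :: "'a::real_normed_vector \<Rightarrow> complex"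
  assumes "contractible S" "continuous_on S f" "f \<in> S \<rightarrow> sphere 0 1"
  obtains \<alpha> where "continuous_on S \<alpha>" "\<And>x. x \<in> S \<Longrightarrow> f x = cis (\<alpha> x)"
proof -
  obtain c where "homotopic_with_canon (\<lambda>x. True) S (sphere 0 1) f (\<lambda>x. c)"
    using nullhomotopic_from_contractible[OF assms(2,3,1)] .
  then show thesis
    using that inessential_eq_continuous_logarithm_circle[of S f] by (auto simp: cis_conv_exp)
qed

section \<open>Winding numbers and degrees of circle-valued loops\<close>

text \<open>The winding number is the increment of some continuous logarithm \<open>q\<close> along
  the path. As the path has modulus 1, \<open>q\<close> is purely imaginary, and its angle differs
  from \<open>\<alpha>\<close> by a constant multiple of \<open>2 * pi\<close>, so both have the
  same increment.\<close>

lemma winding_number_cis: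
  assumes "continuous_on {0..1} \<alpha>" "\<And>t. t \<in> {0..1} \<Longrightarrow> p t = cis (\<alpha> t)"
  shows "winding_number p 0 = of_real ((\<alpha> 1 - \<alpha> 0) / (2 * pi))"
proof -
  have "path p"
    unfolding path_def
    by (subst continuous_on_cong[OF refl assms(2)]) (auto intro!: continuous_intros assms(1))
  moreover have "0 \<notin> path_image p"
    using assms(2) by (auto simp: path_image_def)
  ultimately obtain q where q: "path q"
    "pathfinish q - pathstart q = 2 * of_real pi * \<i> * winding_number p 0"
    "\<And>t. t \<in> {0..1} \<Longrightarrow> p t = 0 + exp (q t)"
    using winding_number_as_continuous_log by blast
  have qexp: "exp (q t) = cis (\<alpha> t)" if "t \<in> {0..1}" for t
    using q(3) assms(2) that by simp
  have Re: "Re (q t) = 0" if "t \<in> {0..1}" for t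
    using arg_cong[OF qexp[OF that], of norm] by simp
  have Im: "cis (Im (q t)) = cis (\<alpha> t)" if "t \<in> {0..1}" for t
    using qexp[OF that] Re[OF that] by (simp add: exp_eq_polar)
  have "cis (Im (q t) - \<alpha> t) = 1" if "t \<in> {0..1}" for t
    using Im[OF that] by (simp flip: cis_divide)
  moreover have "continuous_on {0..1} (\<lambda>t. Im (q t) - \<alpha> t)"
    using q(1) by (auto simp: path_def intro!: continuous_intros assms(1))
  ultimately obtain n :: int where n: "\<And>t. t \<in> {0..1} \<Longrightarrow> Im (q t) - \<alpha> t = 2 * pi * n"
    using continuous_cis_eq_1_constant[of "{0..1::real}" "\<lambda>t. Im (q t) - \<alpha> t"] by auto
  have "Im (q 1) - Im (q 0) = \<alpha> 1 - \<alpha> 0"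
    using n[of 0] n[of 1] by simp
  then have "q 1 - q 0 = \<i> * of_real (\<alpha> 1 - \<alpha> 0)"
    using Re[of 0] Re[of 1] by (simp add: complex_eq_iff)
  with q(2) have "\<i> * (2 * of_real pi * winding_number p 0) = \<i> * of_real (\<alpha> 1 - \<alpha> 0)"
    by (simp only: pathfinish_def pathstart_def mult_ac)
  then have "2 * of_real pi * winding_number p 0 = of_real (\<alpha> 1 - \<alpha> 0)"
    by (metis complex_i_not_zero mult_left_cancel)
  then show ?thesis by (simp add: field_simps)
qed

text \<open>Writing \<open>p\<close> as \<open>cis \<alpha>\<close> on the interval turns the
  product into a sum of angles, whose increments add.\<close>

lemma winding_number_mult_cis:
  assumes "continuous_on {0..1} p" "p \<in> {0..1} \<rightarrow> sphere 0 1" "continuous_on {0..1} \<theta>"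
    and "\<And>t. t \<in> {0..1} \<Longrightarrow> q t = p t * cis (\<theta> t)"
  shows "winding_number q 0 = winding_number p 0 + of_real ((\<theta> 1 - \<theta> 0) / (2 * pi))"
proof -
  obtain \<alpha> where \<alpha>: "continuous_on {0..1} \<alpha>" "\<And>t. t \<in> {0..1} \<Longrightarrow> p t = cis (\<alpha> t)"
    using contractible_imp_cis_lift[of "{0..1::real}" p] assms(1,2) 
    by (auto simp: convex_imp_contractible)
  have "winding_number q 0 = of_real (((\<lambda>t. \<alpha> t + \<theta> t) 1 - (\<lambda>t. \<alpha> t + \<theta> t) 0) / (2 * pi))"
    by (rule winding_number_cis)
      (auto intro!: continuous_intros assms(3) \<alpha>(1) simp: assms(4) \<alpha>(2) cis_mult)
  then show ?thesis
    using winding_number_cis[OF \<alpha>] by (simp add: add_divide_distrib diff_divide_distrib)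
qed

text \<open>Reads the degree off a loop known only on the unit interval. Integrality of its winding
  number makes the definite description in \<open>circle_degree\<close> denote.\<close>

lemma circle_degree_eq_winding_number:
  assumes "continuous_on {0..1} p" "p \<in> {0..1} \<rightarrow> sphere 0 1" "p 0 = p 1"
    and "\<And>t. t \<in> {0..1} \<Longrightarrow> g (cis (2 * pi * t)) = p t"
  shows "of_int (circle_degree g) = winding_number p 0"
proof -
  have "winding_number (g \<circ> circlepath 0 1) 0 = winding_number p 0"
    by (rule winding_number_cong) (use assms(4) in \<open>auto simp: circlepath cis_conv_exp mult_ac\<close>)
  moreover have "winding_number p 0 \<in> \<int>"
    using assms(1-3) by (intro integer_winding_number)
      (force simp: path_def pathfinish_def pathstart_def path_image_def)+
  ultimately show ?thesis
    unfolding circle_degree_def by (auto elim!: Ints_cases)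
qed

lemma winding_number_homotopy:
  assumes "continuous_on ({0..1} \<times> {0..1}) H" "H \<in> {0..1::real} \<times> {0..1} \<rightarrow> sphere 0 1"
    and "\<And>s. s \<in> {0..1} \<Longrightarrow> H (s, 0) = H (s, 1)"
  shows "winding_number (\<lambda>t. H (0, t)) 0 = winding_number (\<lambda>t. H (1, t)) 0"
proof (rule winding_number_homotopic_loops)
  have "H p \<noteq> 0" if "p \<in> {0..1} \<times> {0..1}" for p
  proof -
    have "H p \<in> sphere 0 1" using assms(2) that by blast
    then show ?thesis by auto
  qed
  then have "H \<in> {0..1} \<times> {0..1} \<rightarrow> - {0}" by auto
  with assms show "homotopic_loops (- {0}) (\<lambda>t. H (0, t)) (\<lambda>t. H (1, t))"
    unfolding homotopic_loops by (intro exI[of _ H]) (auto simp: pathfinish_def pathstart_def)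
qed

text \<open>Loops with equal winding number are homotopic in the punctured plane; the rest of the
  argument passes from loops to circle maps and from the punctured plane back to the circle.\<close>

lemma winding_number_eq_imp_homotopic_circlemaps:
  fixes f g :: "complex \<Rightarrow> complex"
  assumes f: "continuous_on (sphere 0 1) f" "f \<in> sphere 0 1 \<rightarrow> sphere 0 1"
    and g: "continuous_on (sphere 0 1) g" "g \<in> sphere 0 1 \<rightarrow> sphere 0 1"
    and eq: "winding_number (\<lambda>t. f (cis (2 * pi * t))) 0 = winding_number (\<lambda>t. g (cis (2 * pi * t))) 0"
  shows "homotopic_with_canon (\<lambda>x. True) (sphere 0 1) (sphere 0 1) f g"
proof -
  have loop: "path (\<lambda>t. h (cis (2 * pi * t)))" "0 \<notin> path_image (\<lambda>t. h (cis (2 * pi * t)))"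
    "pathfinish (\<lambda>t. h (cis (2 * pi * t))) = pathstart (\<lambda>t. h (cis (2 * pi * t)))"
    if "continuous_on (sphere 0 1) h" "h \<in> sphere 0 1 \<rightarrow> sphere 0 1" for h :: "complex \<Rightarrow> complex"
  proof -
    show "path (\<lambda>t. h (cis (2 * pi * t)))"
      unfolding path_def by (rule continuous_on_compose2[OF that(1)]) (auto intro!: continuous_intros)
    have "cmod (h (cis (2 * pi * t))) = 1" for t
      using that(2) by (auto simp: Pi_iff)
    then show "0 \<notin> path_image (\<lambda>t. h (cis (2 * pi * t)))"
      unfolding path_image_def by (metis (no_types, lifting) imageE norm_zero zero_neq_one)
  qed (simp add: pathfinish_def pathstart_def)
  have "homotopic_loops (- {0}) (\<lambda>t. f (cis (2 * pi * t))) (\<lambda>t. g (cis (2 * pi * t)))"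
    using winding_number_homotopic_loops_eq[OF loop(1,2)[OF f] loop(1,2)[OF g] loop(3)[OF f] loop(3)[OF g]] eq
    by simp
  \<comment> \<open>Composing with the angle parameter \<open>Arg2pi z / (2 * pi)\<close> turns
    loops into maps on the circle; its jump at \<open>z = 1\<close> is harmless because every stage
    of the homotopy is a closed loop.\<close>
  then have "homotopic_with_canon (\<lambda>x. True) (sphere 0 1) (- {0})
      ((\<lambda>t. f (cis (2 * pi * t))) \<circ> (\<lambda>z. Arg2pi z / (2 * pi)))
      ((\<lambda>t. g (cis (2 * pi * t))) \<circ> (\<lambda>z. Arg2pi z / (2 * pi)))"
    by (rule homotopic_loops_imp_homotopic_circlemaps)
  moreover have "cis (Arg2pi z) = z" if "z \<in> sphere 0 1" for z
    using Arg2pi_eq[of z] that by (simp add: cis_conv_exp)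
  ultimately have "homotopic_with_canon (\<lambda>x. True) (sphere 0 1) (- {0}) f g"
    by (elim homotopic_with_eq) auto
  \<comment> \<open>The radial retraction \<open>z / norm z\<close> pushes the homotopy into the
    circle and fixes \<open>f\<close> and \<open>g\<close>, which already have modulus 1.\<close>
  then have "homotopic_with_canon (\<lambda>x. True) (sphere 0 1) (sphere 0 1)
      ((\<lambda>z. z / of_real (norm z)) \<circ> f) ((\<lambda>z. z / of_real (norm z)) \<circ> g)"
    by (rule homotopic_with_compose_continuous_left) (auto intro!: continuous_intros simp: norm_divide)
  moreover have "cmod (f z) = 1" "cmod (g z) = 1" if "z \<in> sphere 0 1" for z
    using f(2) g(2) that by (auto simp: Pi_iff)
  ultimately show ?thesis
    by (elim homotopic_with_eq) auto
qed

section \<open>Circle-valued maps on the cylinder\<close>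

text \<open>The contraction \<open>(t, z) \<mapsto> (s * t, z)\<close> deforms the cylinder onto its
  bottom circle.\<close>

lemma homotopic_cylinder_restrict_bottom:
  assumes "continuous_on cylinder F" "F \<in> cylinder \<rightarrow> S"
  shows "homotopic_with_canon (\<lambda>x. True) cylinder S (\<lambda>p. F (0, snd p)) F"
proof -
  have "continuous_on ({0..1::real} \<times> cylinder) (\<lambda>q. F (fst q * fst (snd q), snd (snd q)))"
    by (rule continuous_on_compose2[OF assms(1)])
      (auto intro!: continuous_intros simp: cylinder_def mult_le_one)
  moreover have "(\<lambda>q. F (fst q * fst (snd q), snd (snd q))) \<in> {0..1::real} \<times> cylinder \<rightarrow> S"
    using assms(2) by (fastforce simp: cylinder_def mult_le_one)
  ultimately show ?thesis
    by (subst homotopic_with) (auto intro!: exI[of _ "\<lambda>q. F (fst q * fst (snd q), snd (snd q))"])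
qed

text \<open>Up to homotopy both maps are determined by their restrictions to the bottom circle, and
  these are homotopic because they have the same degree.\<close>

lemma cylinder_cis_factor:
  assumes F: "continuous_on cylinder F" "F \<in> cylinder \<rightarrow> sphere 0 1"
    and G: "continuous_on cylinder G" "G \<in> cylinder \<rightarrow> sphere 0 1"
    and eq: "winding_number (\<lambda>t. F (0, cis (2 * pi * t))) 0 = winding_number (\<lambda>t. G (0, cis (2 * pi * t))) 0"
  obtains \<theta> where "continuous_on cylinder \<theta>" "\<And>x. x \<in> cylinder \<Longrightarrow> G x = F x * cis (\<theta> x)"
proof -
  have bottom: "continuous_on (sphere 0 1) (\<lambda>z. E (0, z))" "(\<lambda>z. E (0, z)) \<in> sphere 0 1 \<rightarrow> sphere 0 1"
    if "continuous_on cylinder E" "E \<in> cylinder \<rightarrow> sphere 0 1" for E :: "real \<times> complex \<Rightarrow> complex"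
    using that(2) by (auto simp: cylinder_def intro!: continuous_on_compose2[OF that(1)] continuous_intros)
  have "homotopic_with_canon (\<lambda>x. True) (sphere 0 1) (sphere 0 1) (\<lambda>z. F (0, z)) (\<lambda>z. G (0, z))"
    using winding_number_eq_imp_homotopic_circlemaps bottom[OF F] bottom[OF G] eq by blast
  then have "homotopic_with_canon (\<lambda>x. True) cylinder (sphere 0 1)
      ((\<lambda>z. F (0, z)) \<circ> snd) ((\<lambda>z. G (0, z)) \<circ> snd)"
    by (rule homotopic_with_compose_continuous_right) (auto simp: cylinder_def intro!: continuous_intros)
  then have "homotopic_with_canon (\<lambda>x. True) cylinder (sphere 0 1) (\<lambda>p. F (0, snd p)) (\<lambda>p. G (0, snd p))"
    by (simp add: o_def)
  then have "homotopic_with_canon (\<lambda>x. True) cylinder (sphere 0 1) G F"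
    using homotopic_cylinder_restrict_bottom[OF F] homotopic_cylinder_restrict_bottom[OF G]
    by (meson homotopic_with_symD homotopic_with_trans)
  then show thesis
    using that homotopic_circlemaps_imp_cis_factor by blast
qed

subsection \<open>Maps and sections\<close>

lemma tclass_eq_cases:
  assumes "x \<in> cylinder" "y \<in> cylinder" "tclass M x = tclass M y"
  obtains "x = y"
  | z where "z \<in> sphere 0 1" "x = (0, z)" "y = (1, gluing M z)"
  | z where "z \<in> sphere 0 1" "y = (0, z)" "x = (1, gluing M z)"
  using assms by (auto simp: tclass_eq_iff glue_rel_def)

lemma proj_tclass_fst: "x \<in> cylinder \<Longrightarrow> proj (tclass M x) = bclass (fst x)"
  by (cases x) (simp add: cylinder_def proj_tclass)

interpretation base: space_over_base "{0..1}" base bclass "\<lambda>t. t" "\<lambda>b. b"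
  by unfold_locales (auto simp: quotient_map_bclass)

interpretation total: space_over_base cylinder "total_space M" "tclass M" fst proj for M
  by unfold_locales
    (simp_all add: quotient_map_tclass proj_tclass_fst continuous_on_fst[OF continuous_on_id],
      auto simp: cylinder_def)

lemma over_base_eq: "over_base M = total.over M"
  by (simp add: fun_eq_iff over_base_def total.over_def)

lemma homotopic_sections_eq: "homotopic_sections N = homotopic_with base.over base (total_space N)"
  by (simp add: homotopic_sections_def base.over_def[abs_def])

text \<open>The sign with which the gluing acts on angles: complex conjugation reverses
  them.\<close>

fun orientation :: "surface \<Rightarrow> real" where
  "orientation Torus = 1"
| "orientation Klein = -1"

lemma gluing_mult_cis: "gluing N (w * cis a) = gluing N w * cis (orientation N * a)"
  by (cases N) (auto simp: cis_cnj)

text \<open>The seam condition on the angles is linear, so scaling both by \<open>s\<close>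
  preserves it.\<close>

lemma tclass_rotate:
  assumes "w \<in> sphere 0 1" "w' = gluing N w" "b = orientation N * a"
  shows "tclass N (0, w * cis (s * a)) = tclass N (1, w' * cis (s * b))"
  using assms by (subst tclass_ends) (auto simp: norm_mult gluing_mult_cis mult_ac)

text \<open>Besides lifting, this turns the fact that \<open>f\<close> is defined on glued points
  into an equation between the two ends of \<open>F\<close>.\<close>

lemma map_over_lift:
  assumes "map_over M N f"
  obtains F where "continuous_on cylinder F" "F \<in> cylinder \<rightarrow> sphere 0 1"
    "\<And>x. x \<in> cylinder \<Longrightarrow> f (tclass M x) = tclass N (fst x, F x)"
    "\<And>z. z \<in> sphere 0 1 \<Longrightarrow> F (1, gluing M z) = gluing N (F (0, z))"
proof -
  obtain F where F: "continuous_on cylinder F" "F \<in> cylinder \<rightarrow> sphere 0 1"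
    "\<And>x. x \<in> cylinder \<Longrightarrow> f (tclass M x) = tclass N (fst x, F x)"
    using assms total.over_lift[of M N f] unfolding map_over_def over_base_eq by metis
  have "F (1, gluing M z) = gluing N (F (0, z))" if z: "z \<in> sphere 0 1" for z
  proof -
    have cyl: "(0, z) \<in> cylinder" "(1, gluing M z) \<in> cylinder"
      using z by (auto simp: cylinder_def)
    have "tclass M (0, z) = tclass M (1, gluing M z)"
      using tclass_ends[of z "gluing M z" M] z by simp
    then have "tclass N (0, F (0, z)) = tclass N (1, F (1, gluing M z))"
      using F(3)[OF cyl(1)] F(3)[OF cyl(2)] by simp
    moreover have "F (0, z) \<in> sphere 0 1" "F (1, gluing M z) \<in> sphere 0 1"
      using F(2) cyl by blast+
    ultimately show ?thesis
      using tclass_ends by blast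
  qed
  with F that show thesis by blast
qed

text \<open>The condition on \<open>\<theta>\<close> at the seam is homogeneous, so every
  \<open>s * \<theta>\<close> satisfies it and each intermediate rotation respects both
  gluings.\<close>

lemma homotopic_over_rotation:
  assumes F: "continuous_on cylinder F" "F \<in> cylinder \<rightarrow> sphere 0 1"
      "\<And>x. x \<in> cylinder \<Longrightarrow> f (tclass M x) = tclass N (fst x, F x)"
      "\<And>z. z \<in> sphere 0 1 \<Longrightarrow> F (1, gluing M z) = gluing N (F (0, z))"
    and \<theta>: "continuous_on cylinder \<theta>"
      "\<And>z. z \<in> sphere 0 1 \<Longrightarrow> \<theta> (1, gluing M z) = orientation N * \<theta> (0, z)"
    and g: "\<And>x. x \<in> cylinder \<Longrightarrow> g (tclass M x) = tclass N (fst x, F x * cis (\<theta> x))"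
  shows "homotopic_over M N f g"
  unfolding homotopic_over_def over_base_eq
proof (rule total.homotopic_rotation[OF F(1-3) \<theta>(1) g])
  fix s :: real and x y
  have F0: "F (0, z) \<in> sphere 0 1" if "z \<in> sphere 0 1" for z
    using F(2) that by (auto simp: cylinder_def)
  have ends: "tclass N (0, F (0, z) * cis (s * \<theta> (0, z)))
      = tclass N (1, F (1, gluing M z) * cis (s * \<theta> (1, gluing M z)))"
    if "z \<in> sphere 0 1" for z
    using tclass_rotate[OF F0 F(4) \<theta>(2)] that by blast
  assume "x \<in> cylinder" "y \<in> cylinder" "tclass M x = tclass M y"
  then show "tclass N (fst x, F x * cis (s * \<theta> x)) = tclass N (fst y, F y * cis (s * \<theta> y))"
    by (cases rule: tclass_eq_cases) (simp_all add: ends)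
qed

section \<open>Homotopy classes of sections, in particular of the Klein bottle\<close>

lemma homotopic_sections_rotation:
  assumes S: "continuous_on {0..1} S" "S \<in> {0..1} \<rightarrow> sphere 0 1"
      "\<And>t. t \<in> {0..1} \<Longrightarrow> \<sigma> (bclass t) = tclass N (t, S t)"
      "S 1 = gluing N (S 0)"
    and \<theta>: "continuous_on {0..1} \<theta>" "\<theta> 1 = orientation N * \<theta> 0"
    and \<sigma>': "\<And>t. t \<in> {0..1} \<Longrightarrow> \<sigma>' (bclass t) = tclass N (t, S t * cis (\<theta> t))"
  shows "homotopic_sections N \<sigma> \<sigma>'"
  unfolding homotopic_sections_eq
proof (rule base.homotopic_rotation[OF S(1-3) \<theta>(1) \<sigma>'])
  fix s x y :: real
  have ends: "tclass N (0, S 0 * cis (s * \<theta> 0)) = tclass N (1, S 1 * cis (s * \<theta> 1))"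
    using S(2) by (intro tclass_rotate S(4) \<theta>(2)) auto
  assume "x \<in> {0..1}" "y \<in> {0..1}" "bclass x = bclass y"
  then have "x = y \<or> x = 0 \<and> y = 1 \<or> x = 1 \<and> y = 0"
    by (simp add: bclass_eq_iff)
  with ends show "tclass N (x, S x * cis (s * \<theta> x)) = tclass N (y, S y * cis (s * \<theta> y))"
    by auto
qed

text \<open>The lifts \<open>\<eta>\<close> below satisfy \<open>\<eta> (s, 1) + \<eta> (s, 0) = 2\<pi>m\<close> for a fixed integer \<open>m\<close>, and \<open>\<theta>\<close> agrees with
  \<open>\<eta> (1, _) - \<eta> (0, _)\<close> up to a constant \<open>2\<pi>n\<close>, which is counted twice in \<open>\<theta> 1 + \<theta> 0\<close>.\<close>

lemma homotopic_sections_Klein_iff: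
  assumes S: "continuous_on {0..1} S" "S \<in> {0..1} \<rightarrow> sphere 0 1" "S 1 = cnj (S 0)"
    and \<sigma>: "\<And>t. t \<in> {0..1} \<Longrightarrow> \<sigma> (bclass t) = tclass Klein (t, S t)"
    and \<theta>: "continuous_on {0..1} \<theta>"
    and \<sigma>': "\<And>t. t \<in> {0..1} \<Longrightarrow> \<sigma>' (bclass t) = tclass Klein (t, S t * cis (\<theta> t))"
  shows "homotopic_sections Klein \<sigma> \<sigma>' \<longleftrightarrow> (\<exists>n::int. \<theta> 1 + \<theta> 0 = 4 * pi * n)"
proof
  assume "\<exists>n::int. \<theta> 1 + \<theta> 0 = 4 * pi * n"
  then obtain n :: int where n: "\<theta> 1 + \<theta> 0 = 4 * pi * n" ..
  show "homotopic_sections Klein \<sigma> \<sigma>'"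
  \<comment> \<open>Shifting the angle by \<open>2 * pi * n\<close> leaves \<open>cis\<close>
    unchanged and brings the sum of the two end values to zero, which is the seam condition for the
    Klein bottle.\<close>
  proof (rule homotopic_sections_rotation[where S = S and \<theta> = "\<lambda>t. \<theta> t - 2 * pi * n"])
    show "continuous_on {0..1} (\<lambda>t. \<theta> t - 2 * pi * n)"
      by (intro continuous_intros \<theta>)
    show "\<theta> 1 - 2 * pi * n = orientation Klein * (\<theta> 0 - 2 * pi * n)"
      using n by (simp add: algebra_simps)
    have "cis (\<theta> t - 2 * pi * n) = cis (\<theta> t)" for t
      by (subst cis_eq_iff) (auto intro: exI[of _ "-n"])
    then show "\<sigma>' (bclass t) = tclass Klein (t, S t * cis (\<theta> t - 2 * pi * n))" if "t \<in> {0..1}" for t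
      using \<sigma>' that by simp
  qed (use S \<sigma> in auto)
next
  assume hom: "homotopic_sections Klein \<sigma> \<sigma>'"
  have rot: "(\<lambda>t. S t * cis (\<theta> t)) \<in> {0..1} \<rightarrow> sphere 0 1"
    using S(2) by (auto simp: norm_mult Pi_iff)
  obtain H where H: "continuous_on ({0..1} \<times> {0..1}) H" "H \<in> {0..1::real} \<times> {0..1} \<rightarrow> sphere 0 1"
    "\<And>t. t \<in> {0..1} \<Longrightarrow> H (0, t) = S t" "\<And>t. t \<in> {0..1} \<Longrightarrow> H (1, t) = S t * cis (\<theta> t)"
    "\<And>s x y. s \<in> {0..1} \<Longrightarrow> x \<in> {0..1} \<Longrightarrow> y \<in> {0..1} \<Longrightarrow> bclass x = bclass y \<Longrightarrow>
       tclass Klein (x, H (s, x)) = tclass Klein (y, H (s, y))"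
    using base.homotopy_lift[OF hom[unfolded homotopic_sections_eq] S(2) \<sigma> rot \<sigma>'] by blast
  have Hends: "H (s, 1) = cnj (H (s, 0))" if s: "s \<in> {0..1}" for s
  proof -
    have "tclass Klein (0, H (s, 0)) = tclass Klein (1, H (s, 1))"
      using H(5)[OF s, of 0 1] by (simp add: bclass_eq_iff)
    moreover have "H (s, 0) \<in> sphere 0 1" "H (s, 1) \<in> sphere 0 1"
      using H(2) s by auto
    ultimately show ?thesis using tclass_ends by force
  qed
  \<comment> \<open>The parameter square is contractible, so the whole homotopy has one continuous
    angle.\<close>
  obtain \<eta> where \<eta>: "continuous_on ({0..1} \<times> {0..1}) \<eta>"
    "\<And>x. x \<in> {0..1} \<times> {0..1} \<Longrightarrow> H x = cis (\<eta> x)"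
    using contractible_imp_cis_lift[OF _ H(1,2)] by (auto simp: convex_imp_contractible convex_Times)
  have "cis (\<eta> (s, 1) + \<eta> (s, 0)) = 1" if "s \<in> {0..1}" for s
  proof -
    have "cis (\<eta> (s, 1)) = cis (- \<eta> (s, 0))"
      using Hends[OF that] \<eta>(2)[of "(s, 0)"] \<eta>(2)[of "(s, 1)"] that by (simp add: cis_cnj)
    then have "cis (\<eta> (s, 1) + \<eta> (s, 0)) = cis (- \<eta> (s, 0)) * cis (\<eta> (s, 0))"
      by (simp only: cis_mult[symmetric])
    then show ?thesis by (simp add: cis_mult)
  qed
  moreover have "continuous_on {0..1} (\<lambda>s. \<eta> (s, 1) + \<eta> (s, 0))"
    by (intro continuous_intros continuous_on_compose2[OF \<eta>(1)]) auto
  ultimately obtain m :: int where m: "\<And>s. s \<in> {0..1} \<Longrightarrow> \<eta> (s, 1) + \<eta> (s, 0) = 2 * pi * m"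
    using continuous_cis_eq_1_constant[of "{0..1::real}" "\<lambda>s. \<eta> (s, 1) + \<eta> (s, 0)"] by auto
  have "cis (\<theta> t - (\<eta> (1, t) - \<eta> (0, t))) = 1" if "t \<in> {0..1}" for t
  proof -
    have "cis (\<eta> (1, t)) = cis (\<eta> (0, t)) * cis (\<theta> t)"
      using H(3,4)[OF that] \<eta>(2)[of "(0, t)"] \<eta>(2)[of "(1, t)"] that by simp
    then show ?thesis by (simp flip: cis_divide)
  qed
  moreover have "continuous_on {0..1} (\<lambda>t. \<theta> t - (\<eta> (1, t) - \<eta> (0, t)))"
    by (intro continuous_intros \<theta> continuous_on_compose2[OF \<eta>(1)]) auto
  ultimately obtain n :: int where n: "\<And>t. t \<in> {0..1} \<Longrightarrow> \<theta> t - (\<eta> (1, t) - \<eta> (0, t)) = 2 * pi * n"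
    using continuous_cis_eq_1_constant[of "{0..1::real}" "\<lambda>t. \<theta> t - (\<eta> (1, t) - \<eta> (0, t))"] by auto
  \<comment> \<open>The sums of \<open>\<eta>\<close> over the two ends equal
    \<open>2 * pi * m\<close> at both \<open>s = 0\<close> and \<open>s = 1\<close>, so they cancel
    and only the two copies of \<open>2 * pi * n\<close> remain.\<close>
  have "\<theta> 1 + \<theta> 0 = 4 * pi * n"
    using m[of 0] m[of 1] n[of 0] n[of 1] by simp
  then show "\<exists>n::int. \<theta> 1 + \<theta> 0 = 4 * pi * n" ..
qed

text \<open>For an angle \<open>\<alpha>\<close> of the section, the seam forces
  \<open>\<alpha> 1 + \<alpha> 0 = 2 * pi * k\<close>; the parity of \<open>k\<close> decides which
  of the two constant sections it is homotopic to.\<close>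

lemma klein_section_dichotomy:
  assumes S: "continuous_on {0..1} S" "S \<in> {0..1} \<rightarrow> sphere 0 1" "S 1 = cnj (S 0)"
    and \<sigma>: "\<And>t. t \<in> {0..1} \<Longrightarrow> \<sigma> (bclass t) = tclass Klein (t, S t)"
  shows "homotopic_sections Klein \<sigma> (const_section Klein (-1))
    \<longleftrightarrow> \<not> homotopic_sections Klein \<sigma> (const_section Klein 1)"
proof -
  obtain \<alpha> where \<alpha>: "continuous_on {0..1} \<alpha>" "\<And>t. t \<in> {0..1} \<Longrightarrow> S t = cis (\<alpha> t)"
    using contractible_imp_cis_lift[OF _ S(1,2)] by (auto simp: convex_imp_contractible)
  have sym: "homotopic_sections Klein \<sigma> \<rho> \<longleftrightarrow> homotopic_sections Klein \<rho> \<sigma>" for \<rho>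
    unfolding homotopic_sections_eq by (rule homotopic_with_sym)
  have "cis (\<alpha> 1) = cis (- \<alpha> 0)"
    using S(3) \<alpha>(2)[of 0] \<alpha>(2)[of 1] by (simp add: cis_cnj)
  then obtain k :: int where k: "\<alpha> 1 + \<alpha> 0 = 2 * pi * k"
    unfolding cis_eq_iff by auto
  have "homotopic_sections Klein (const_section Klein 1) \<sigma> \<longleftrightarrow> (\<exists>n::int. \<alpha> 1 + \<alpha> 0 = 4 * pi * n)"
    by (rule homotopic_sections_Klein_iff[where S = "\<lambda>_. 1"])
      (auto simp: const_section_bclass \<sigma> \<alpha>)
  also have "\<dots> \<longleftrightarrow> even k"
  proof -
    have "2 * pi * k = 4 * pi * n \<longleftrightarrow> k = 2 * n" for n :: int
    proof -
      have "2 * pi * k = 4 * pi * n \<longleftrightarrow> real_of_int k = real_of_int (2 * n)" by simp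
      then show ?thesis by (simp only: of_int_eq_iff)
    qed
    then show ?thesis unfolding k by (auto simp: dvd_def)
  qed
  finally have 1: "homotopic_sections Klein (const_section Klein 1) \<sigma> \<longleftrightarrow> even k" .
  \<comment> \<open>Measured from the constant -1 the angle is \<open>\<alpha> t - pi\<close>. The
    sum over the ends drops by \<open>2 * pi\<close>, which exchanges even and odd.\<close>
  have "homotopic_sections Klein (const_section Klein (-1)) \<sigma>
      \<longleftrightarrow> (\<exists>n::int. (\<alpha> 1 - pi) + (\<alpha> 0 - pi) = 4 * pi * n)"
    by (rule homotopic_sections_Klein_iff[where S = "\<lambda>_. -1"])
      (auto simp: const_section_bclass \<sigma> \<alpha> simp flip: cis_divide intro!: continuous_intros)
  also have "\<dots> \<longleftrightarrow> odd k"
  proof -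
    have "2 * pi * k - 2 * pi = 4 * pi * n \<longleftrightarrow> k = 2 * n + 1" for n :: int
    proof -
      have "2 * pi * k - 2 * pi = 4 * pi * n \<longleftrightarrow> (2 * pi) * k = (2 * pi) * (2 * n + 1)"
        by (auto simp: algebra_simps)
      also have "\<dots> \<longleftrightarrow> real_of_int k = real_of_int (2 * n + 1)"
        by (subst mult_left_cancel) auto
      finally show ?thesis by (simp only: of_int_eq_iff)
    qed
    moreover have "(\<alpha> 1 - pi) + (\<alpha> 0 - pi) = 2 * pi * k - 2 * pi"
      using k by simp
    ultimately show ?thesis by (auto elim: oddE)
  qed
  finally show ?thesis using 1 sym by blast
qed

section \<open>The invariants expressed through sections and lifts\<close>

lemma const_section_continuous_map: "continuous_map base (total_space M) (const_section M 1)"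
proof (rule continuous_compose_quotient_map[OF quotient_map_bclass])
  have "continuous_map (top_of_set {0..1}) (top_of_set cylinder) (\<lambda>t. (t, 1))"
    by (auto simp: cylinder_def intro!: continuous_intros)
  from continuous_map_compose[OF this quotient_imp_continuous_map[OF quotient_map_tclass[of M]]]
  show "continuous_map (top_of_set {0..1}) (total_space M) (const_section M 1 \<circ> bclass)"
    by (rule continuous_map_eq) (auto simp: const_section_bclass)
qed

lemma proj_const_section: "x \<in> topspace base \<Longrightarrow> proj (const_section M 1 x) = x"
  by (auto simp: topspace_base const_section_bclass proj_tclass)

text \<open>By the dichotomy there are exactly two classes, so the invariant is a complete one for
  the sections obtained by restricting maps.\<close>

lemma klein_section_invariant_eq_iff:
  assumes f: "map_over M Klein f" and g: "map_over M Klein g"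
  shows "section_invariant M Klein f = section_invariant M Klein g \<longleftrightarrow>
    homotopic_sections Klein (f \<circ> const_section M 1) (g \<circ> const_section M 1)"
proof -
  define sect where "sect h = h \<circ> const_section M 1" for h :: "(real \<times> complex) set \<Rightarrow> (real \<times> complex) set"
  define P where "P h e \<longleftrightarrow> homotopic_sections Klein (sect h) (const_section Klein e)" for h e
  have dich: "P h (-1) \<longleftrightarrow> \<not> P h 1" if h: "map_over M Klein h" for h
  proof -
    obtain F where F: "continuous_on cylinder F" "F \<in> cylinder \<rightarrow> sphere 0 1"
      "\<And>x. x \<in> cylinder \<Longrightarrow> h (tclass M x) = tclass Klein (fst x, F x)"
      "\<And>z. z \<in> sphere 0 1 \<Longrightarrow> F (1, gluing M z) = gluing Klein (F (0, z))"
      using map_over_lift[OF h] by metis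
    show ?thesis unfolding P_def
    proof (rule klein_section_dichotomy[where S = "\<lambda>t. F (t, 1)"])
      show "continuous_on {0..1} (\<lambda>t. F (t, 1))"
        by (rule continuous_on_compose2[OF F(1)]) (auto simp: cylinder_def intro!: continuous_intros)
      show "(\<lambda>t. F (t, 1)) \<in> {0..1} \<rightarrow> sphere 0 1"
        using F(2) by (auto simp: cylinder_def)
      show "F (1, 1) = cnj (F (0, 1))" using F(4)[of 1] by simp
      show "sect h (bclass t) = tclass Klein (t, F (t, 1))" if "t \<in> {0..1}" for t
        using F(3)[of "(t, 1)"] that by (simp add: sect_def const_section_bclass cylinder_def)
    qed
  qed
  \<comment> \<open>Exactly one of the two alternatives holds, so the definite description has a
    unique solution.\<close>
  have inv: "section_invariant M Klein h = Inr (if P h 1 then 0 else 1)" if "map_over M Klein h" for h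
    using dich[OF that] by (auto simp: P_def sect_def intro!: the_equality)
  have sym: "homotopic_sections Klein \<rho> \<rho>' \<Longrightarrow> homotopic_sections Klein \<rho>' \<rho>"
    and trans: "homotopic_sections Klein \<rho> \<rho>' \<Longrightarrow> homotopic_sections Klein \<rho>' \<rho>'' \<Longrightarrow> homotopic_sections Klein \<rho> \<rho>''"
    for \<rho> \<rho>' \<rho>''
    unfolding homotopic_sections_eq by (blast intro: homotopic_with_symD homotopic_with_trans)+
  have "section_invariant M Klein f = section_invariant M Klein g \<longleftrightarrow> (P f 1 \<longleftrightarrow> P g 1)"
    using inv[OF f] inv[OF g] by simp
  \<comment> \<open>If neither section is homotopic to the constant 1, both are homotopic to the
    constant -1 and hence to each other.\<close>
  also have "\<dots> \<longleftrightarrow> homotopic_sections Klein (sect f) (sect g)"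
    using dich[OF f] dich[OF g] unfolding P_def by (meson sym trans)
  finally show ?thesis unfolding sect_def .
qed

text \<open>In the coordinate \<open>cis (2 * pi * t)\<close> on the base, the composite defining
  the invariant is \<open>t \<mapsto> F (t, 1)\<close>. This loop closes because the source gluing
  fixes 1 and the target gluing is the identity.\<close>

lemma torus_section_invariant_eq:
  assumes F: "continuous_on cylinder F" "F \<in> cylinder \<rightarrow> sphere 0 1"
      "\<And>x. x \<in> cylinder \<Longrightarrow> f (tclass M x) = tclass Torus (fst x, F x)"
      "\<And>z. z \<in> sphere 0 1 \<Longrightarrow> F (1, gluing M z) = gluing Torus (F (0, z))"
  obtains d where "section_invariant M Torus f = Inl d"
    "of_int d = winding_number (\<lambda>t. F (t, 1)) 0"
proof
  have "inv_into (topspace base) base_to_circle (cis (2 * pi * t)) = bclass t" if "t \<in> {0..1}" for t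
    using bij_betw_base_to_circle that inv_into_f_f[of base_to_circle "topspace base" "bclass t"]
    by (simp add: base_to_circle_bclass topspace_base bij_betw_def)
  moreover have "F (t, 1) \<in> sphere 0 1" if "t \<in> {0..1}" for t
    using F(2) that by (auto simp: cylinder_def)
  ultimately show "of_int (circle_degree (torus_fibre_coord \<circ> f \<circ> const_section M 1
      \<circ> inv_into (topspace base) base_to_circle)) = winding_number (\<lambda>t. F (t, 1)) 0"
    using F(3) F(4)[of 1]
    by (intro circle_degree_eq_winding_number)
      (auto simp: const_section_bclass cylinder_def torus_fibre_coord_tclass
        intro!: continuous_on_compose2[OF F(1)] continuous_intros)
qed simp

lemma fibre_degree_eq:
  assumes F: "continuous_on cylinder F" "F \<in> cylinder \<rightarrow> sphere 0 1"
      "\<And>x. x \<in> cylinder \<Longrightarrow> f (tclass M x) = tclass N (fst x, F x)"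
  shows "of_int (fibre_degree M N f) = winding_number (\<lambda>t. F (0, cis (2 * pi * t))) 0"
  unfolding fibre_degree_def
proof (rule circle_degree_eq_winding_number)
  fix t :: real
  have cyl: "(0, cis (2 * pi * t)) \<in> cylinder" by (simp add: cylinder_def)
  then have "f (fibre_incl M (cis (2 * pi * t))) = fibre_incl N (F (0, cis (2 * pi * t)))"
    by (simp add: fibre_incl_def F(3))
  moreover have "F (0, cis (2 * pi * t)) \<in> sphere 0 1"
    using F(2) cyl by blast
  ultimately show "inv_into (sphere 0 1) (fibre_incl N) (f (fibre_incl M (cis (2 * pi * t))))
      = F (0, cis (2 * pi * t))"
    using bij_betw_fibre_incl[of N] by (simp add: bij_betw_def inv_into_f_f)
next
  show "(\<lambda>t. F (0, cis (2 * pi * t))) \<in> {0..1} \<rightarrow> sphere 0 1"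
    using F(2) by (auto simp: cylinder_def)
  show "continuous_on {0..1} (\<lambda>t. F (0, cis (2 * pi * t)))"
    by (intro continuous_on_compose2[OF F(1)] continuous_intros) (auto simp: cylinder_def)
qed simp

section \<open>Classification of maps over the circle up to homotopy\<close>

theorem proposition1p1:
  fixes M N :: surface
    and f g :: "(real \<times> complex) set \<Rightarrow> (real \<times> complex) set"
  assumes "map_over M N f" and "map_over M N g"
  shows "homotopic_over M N f g \<longleftrightarrow>
    fibre_degree M N f = fibre_degree M N g \<and> section_invariant M N f = section_invariant M N g"
proof -
  obtain F where F: "continuous_on cylinder F" "F \<in> cylinder \<rightarrow> sphere 0 1"
    "\<And>x. x \<in> cylinder \<Longrightarrow> f (tclass M x) = tclass N (fst x, F x)"
    "\<And>z. z \<in> sphere 0 1 \<Longrightarrow> F (1, gluing M z) = gluing N (F (0, z))"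
    using map_over_lift[OF assms(1)] by metis
  obtain G where G: "continuous_on cylinder G" "G \<in> cylinder \<rightarrow> sphere 0 1"
    "\<And>x. x \<in> cylinder \<Longrightarrow> g (tclass M x) = tclass N (fst x, G x)"
    "\<And>z. z \<in> sphere 0 1 \<Longrightarrow> G (1, gluing M z) = gluing N (G (0, z))"
    using map_over_lift[OF assms(2)] by metis
  have degree_iff: "fibre_degree M N f = fibre_degree M N g \<longleftrightarrow>
      winding_number (\<lambda>t. F (0, cis (2 * pi * t))) 0 = winding_number (\<lambda>t. G (0, cis (2 * pi * t))) 0"
    by (simp flip: fibre_degree_eq[OF F(1-3)] fibre_degree_eq[OF G(1-3)])
  have torus_iff: "section_invariant M N f = section_invariant M N g \<longleftrightarrow>
      winding_number (\<lambda>t. F (t, 1)) 0 = winding_number (\<lambda>t. G (t, 1)) 0" if N: "N = Torus"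
  proof -
    obtain d e where "section_invariant M Torus f = Inl d" "section_invariant M Torus g = Inl e"
      "of_int d = winding_number (\<lambda>t. F (t, 1)) 0" "of_int e = winding_number (\<lambda>t. G (t, 1)) 0"
      using torus_section_invariant_eq[OF F[unfolded N]] torus_section_invariant_eq[OF G[unfolded N]]
      by metis
    then show ?thesis by (simp add: N) (metis of_int_eq_iff)
  qed
  show ?thesis
  proof (intro iffI conjI)
    assume hom: "homotopic_over M N f g"
    obtain H where H: "continuous_on ({0..1} \<times> cylinder) H" "H \<in> {0..1::real} \<times> cylinder \<rightarrow> sphere 0 1"
      "\<And>x. x \<in> cylinder \<Longrightarrow> H (0, x) = F x" "\<And>x. x \<in> cylinder \<Longrightarrow> H (1, x) = G x"
      "\<And>s x y. s \<in> {0..1} \<Longrightarrow> x \<in> cylinder \<Longrightarrow> y \<in> cylinder \<Longrightarrow> tclass M x = tclass M y \<Longrightarrow>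
         tclass N (fst x, H (s, x)) = tclass N (fst y, H (s, y))"
      using total.homotopy_lift[OF hom[unfolded homotopic_over_def over_base_eq] F(2,3) G(2,3)] by blast
    \<comment> \<open>Restricting the lifted homotopy to the fibre at height 0 gives a homotopy of
      closed loops.\<close>
    have "winding_number (\<lambda>t. H (0, 0, cis (2 * pi * t))) 0 = winding_number (\<lambda>t. H (1, 0, cis (2 * pi * t))) 0"
      using H(2)
      by (intro winding_number_homotopy[of "\<lambda>(s, t). H (s, 0, cis (2 * pi * t))", simplified])
        (auto simp: cylinder_def case_prod_beta intro!: continuous_on_compose2[OF H(1)] continuous_intros)
    then show "fibre_degree M N f = fibre_degree M N g"
      by (simp add: degree_iff H(3,4) cylinder_def)
    show "section_invariant M N f = section_invariant M N g"
    proof (cases N)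
      case Torus
      \<comment> \<open>The gluing of \<open>M\<close> fixes 1, so \<open>(0, 1)\<close> and
        \<open>(1, 1)\<close> are identified for either source; with trivial gluing in the target
        the loop at stage \<open>s\<close> closes.\<close>
      have "H (s, 0, 1) = H (s, 1, 1)" if s: "s \<in> {0..1}" for s
      proof -
        have "tclass Torus (0, H (s, 0, 1)) = tclass Torus (1, H (s, 1, 1))"
          using H(5)[OF s, of "(0, 1)" "(1, 1)"] Torus by (simp add: cylinder_def tclass_ends)
        moreover have "H (s, 0, 1) \<in> sphere 0 1" "H (s, 1, 1) \<in> sphere 0 1"
          using H(2) s by (auto simp: cylinder_def)
        ultimately show ?thesis using tclass_ends by force
      qed
      then have "winding_number (\<lambda>t. H (0, t, 1)) 0 = winding_number (\<lambda>t. H (1, t, 1)) 0"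
        using H(2)
        by (intro winding_number_homotopy[of "\<lambda>(s, t). H (s, t, 1)", simplified])
          (auto simp: cylinder_def case_prod_beta intro!: continuous_on_compose2[OF H(1)] continuous_intros)
      moreover have "winding_number (\<lambda>t. H (0, t, 1)) 0 = winding_number (\<lambda>t. F (t, 1)) 0"
        "winding_number (\<lambda>t. H (1, t, 1)) 0 = winding_number (\<lambda>t. G (t, 1)) 0"
        by (rule winding_number_cong; simp add: H(3,4) cylinder_def)+
      ultimately show ?thesis by (simp add: torus_iff[OF Torus])
    next
      case Klein
      \<comment> \<open>Precomposition with the section through 1 turns a homotopy over the circle
        into one of sections.\<close>
      have "homotopic_sections Klein (f \<circ> const_section M 1) (g \<circ> const_section M 1)"
        unfolding homotopic_sections_eq
      proof (rule homotopic_with_compose_continuous_map_right)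
        show "homotopic_with (total.over M) (total_space M) (total_space Klein) f g"
          using hom by (simp add: homotopic_over_def over_base_eq Klein)
        show "base.over (j \<circ> const_section M 1)" if "total.over M j" for j
          using that continuous_map_image_subset_topspace[OF const_section_continuous_map[of M]]
          by (auto simp: total.over_def base.over_def proj_const_section)
      qed (rule const_section_continuous_map)
      then show ?thesis
        using klein_section_invariant_eq_iff assms Klein by simp
    qed
  next
    assume inv: "fibre_degree M N f = fibre_degree M N g \<and> section_invariant M N f = section_invariant M N g"
    then obtain \<theta> where \<theta>: "continuous_on cylinder \<theta>" "\<And>x. x \<in> cylinder \<Longrightarrow> G x = F x * cis (\<theta> x)"
      using cylinder_cis_factor[OF F(1,2) G(1,2)] by (auto simp: degree_iff)
    have cyl: "(0, z) \<in> cylinder" "(1, gluing M z) \<in> cylinder" if "z \<in> sphere 0 1" for z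
      using that by (auto simp: cylinder_def)
    \<comment> \<open>Both lifts satisfy the seam equation; substituting
      \<open>G = F * cis \<theta>\<close> and cancelling the nonzero factor
      \<open>F (1, gluing M z)\<close> leaves a condition on \<open>\<theta>\<close> alone.\<close>
    have "cis (\<theta> (1, gluing M z) - orientation N * \<theta> (0, z)) = 1" if z: "z \<in> sphere 0 1" for z
    proof -
      have "F (1, gluing M z) * cis (\<theta> (1, gluing M z)) = F (1, gluing M z) * cis (orientation N * \<theta> (0, z))"
        using G(4)[OF z] F(4)[OF z] \<theta>(2)[OF cyl(1)[OF z]] \<theta>(2)[OF cyl(2)[OF z]]
        by (simp add: gluing_mult_cis)
      moreover have "F (1, gluing M z) \<in> sphere 0 1"
        using F(2) cyl(2)[OF z] by blast
      ultimately show ?thesis by (auto simp flip: cis_divide)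
    qed
    moreover have "continuous_on (sphere 0 1) (\<lambda>z. \<theta> (1, gluing M z) - orientation N * \<theta> (0, z))"
    proof -
      have "continuous_on (sphere 0 1) (gluing M)"
        by (cases M) (auto simp: fun_eq_iff intro!: continuous_intros cong: continuous_on_cong)
      then show ?thesis
        by (intro continuous_intros continuous_on_compose2[OF \<theta>(1)]) (auto simp: cylinder_def)
    qed
    moreover have "connected (sphere (0::complex) 1)"
      by (simp add: connected_sphere)
    \<comment> \<open>Connectedness of the fibre circle makes the integer independent of
      \<open>z\<close>, so evaluating at \<open>z = 1\<close> determines it.\<close>
    ultimately obtain n :: int
      where n: "\<And>z. z \<in> sphere 0 1 \<Longrightarrow> \<theta> (1, gluing M z) - orientation N * \<theta> (0, z) = 2 * pi * n"
      using continuous_cis_eq_1_constant by blast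
    have path: "continuous_on {0..1} (\<lambda>t. F (t, 1))" "continuous_on {0..1} (\<lambda>t. \<theta> (t, 1))"
      by (auto intro!: continuous_on_compose2[OF F(1)] continuous_on_compose2[OF \<theta>(1)] continuous_intros
          simp: cylinder_def)
    have pathF: "(\<lambda>t. F (t, 1)) \<in> {0..1} \<rightarrow> sphere 0 1"
      using F(2) by (auto simp: cylinder_def)
    have pathG: "G (t, 1) = F (t, 1) * cis (\<theta> (t, 1))" if "t \<in> {0..1}" for t
      using \<theta>(2) that by (simp add: cylinder_def)
    show "homotopic_over M N f g"
    proof (cases N)
      case Torus
      have "winding_number (\<lambda>t. F (t, 1)) 0 = winding_number (\<lambda>t. G (t, 1)) 0"
        using inv torus_iff[OF Torus] by simp
      \<comment> \<open>The winding numbers along the section through 1 differ by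
        \<open>(\<theta> (1, 1) - \<theta> (0, 1)) / (2 * pi)\<close>.\<close>
      then have "\<theta> (1, 1) = \<theta> (0, 1)"
        using winding_number_mult_cis[OF path(1) pathF path(2) pathG] by simp
      then have "n = 0" using n[of 1] Torus by simp
      then show ?thesis
        using n \<theta> G(3) by (intro homotopic_over_rotation[OF F \<theta>(1)]) auto
    next
      case Klein
      have "homotopic_sections Klein (f \<circ> const_section M 1) (g \<circ> const_section M 1)"
        using klein_section_invariant_eq_iff assms inv Klein by simp
      moreover have "(f \<circ> const_section M 1) (bclass t) = tclass Klein (t, F (t, 1))"
        "(g \<circ> const_section M 1) (bclass t) = tclass Klein (t, F (t, 1) * cis (\<theta> (t, 1)))"
        if "t \<in> {0..1}" for t
        using F(3)[of "(t, 1)"] G(3)[of "(t, 1)"] pathG that Klein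
        by (simp_all add: const_section_bclass cylinder_def)
      moreover have "F (1, 1) = cnj (F (0, 1))"
        using F(4)[of 1] Klein by simp
      \<comment> \<open>Compared with the seam constant at \<open>z = 1\<close>, this says
        \<open>n = 2 * m\<close>.\<close>
      ultimately obtain m :: int where m: "\<theta> (1, 1) + \<theta> (0, 1) = 4 * pi * m"
        using homotopic_sections_Klein_iff[OF path(1) pathF _ _ path(2)] by blast
      have shift: "cis (\<theta> x - 2 * pi * m) = cis (\<theta> x)" for x
        by (subst cis_eq_iff) (auto intro: exI[of _ "-m"])
      show ?thesis
      proof (rule homotopic_over_rotation[OF F, where \<theta> = "\<lambda>x. \<theta> x - 2 * pi * m"])
        show "continuous_on cylinder (\<lambda>x. \<theta> x - 2 * pi * m)"
          by (intro continuous_intros \<theta>(1))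
        show "\<theta> (1, gluing M z) - 2 * pi * m = orientation N * (\<theta> (0, z) - 2 * pi * m)"
          if "z \<in> sphere 0 1" for z
          \<comment> \<open>The constant \<open>2 * pi * n\<close> equals \<open>4 * pi * m\<close>
            at every \<open>z\<close>, so removing \<open>2 * pi * m\<close> at each end makes the
            two values opposite.\<close>
          using n[OF that] n[of 1] m Klein by (simp add: algebra_simps)
        show "g (tclass M x) = tclass N (fst x, F x * cis (\<theta> x - 2 * pi * m))" if "x \<in> cylinder" for x
          using G(3) \<theta>(2) that by (simp add: shift)
      qed
    qed
  qed
qed

end
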